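(* Let $L,\beta,r>0$, $\alpha,\delta\in\mathbb{R}$, and put $\tilde\alpha=\alpha/\beta$, $\tilde\delta=\delta/\beta$, $\tilde r=r/\beta$. There exists a $C^\infty$-function $G=G(s,t)$ on $\Delta_{s,t}=\{(s,t)\in\mathbb{R}^2: s\in(0,L),\ t\in(0,L-s)\}$ such that $G$ solves the integral equation $$G(s,t)=-\frac{\tilde r}{3}st+\int_0^t\int_0^s\int_0^\omega[DG](\xi,\eta)\,d\xi\,d\omega\,d\eta$$ as well as the boundary value problem $$\begin{cases}3G_{sst}-3G_{tts}+G_{ttt}+i\tilde\alpha(2G_{ts}-G_{tt})+\tilde\delta G_t-\tilde rG=0,\\ G(0,t)=G(s,0)=0,\\ G_s(0,t)=-\dfrac{\tilde rt}{3},\end{cases}$$ where $(s,t)\in\Delta_{s,t}$.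
   Context: Here $DG=\frac13\left[3G_{tts}-G_{ttt}-i\tilde\alpha(2G_{ts}-G_{tt})-\tilde\delta G_t+\tilde rG\right]$. $G$ is complex valued and smooth up to the boundary of $\Delta_{s,t}$, so that the boundary conditions make sense pointwise. *)

theory Defs
  imports "HOL-Analysis.Analysis"
begin

definition Delta :: "real \<Rightarrow> (real \<times> real) set" where
  "Delta L = {(s, t). s \<in> {0<..<L} \<and> t \<in> {0<..<L - s}}"

text \<open>
  Directional derivative of a function on \<open>S\<close>.  It is obtained from the derivative \<^emph>\<open>within\<close> \<open>S\<close>:
  at interior points of \<open>S\<close> this is the ordinary derivative, at boundary points it only depends on
  the values of the function on \<open>S\<close>.  If \<open>S\<close> is convex with nonempty interior, as is the closed
  triangle, then the derivative within \<open>S\<close> is unique at every point of \<open>S\<close>, including corners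
  where \<open>S\<close> contains no segment in direction \<open>v\<close>.
\<close>

definition dir_deriv ::
  "'a::real_normed_vector set \<Rightarrow> 'a \<Rightarrow> ('a \<Rightarrow> 'b::real_normed_vector) \<Rightarrow> 'a \<Rightarrow> 'b" where
  "dir_deriv S v f = (\<lambda>p. frechet_derivative f (at p within S) v)"

text \<open>
  Partial derivatives of all orders and in any order exist and are differentiable (hence
  continuous) on \<open>S\<close>.  For a closed region \<open>S\<close> this is smoothness up to the boundary.
\<close>

definition smooth_on :: "'a::euclidean_space set \<Rightarrow> ('a \<Rightarrow> 'b::real_normed_vector) \<Rightarrow> bool" where
  "smooth_on S f \<longleftrightarrow>
     (\<forall>vs. set vs \<subseteq> Basis \<longrightarrow> fold (dir_deriv S) vs f differentiable_on S)"

definition pd_s :: "(real \<times> real) set \<Rightarrow> (real \<times> real \<Rightarrow> complex) \<Rightarrow> real \<times> real \<Rightarrow> complex" where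
  "pd_s S = dir_deriv S (1, 0)"

definition pd_t :: "(real \<times> real) set \<Rightarrow> (real \<times> real \<Rightarrow> complex) \<Rightarrow> real \<times> real \<Rightarrow> complex" where
  "pd_t S = dir_deriv S (0, 1)"

text \<open>
  The operator \<open>D\<close>; the real parameters \<open>a\<close>, \<open>d\<close>, \<open>\<rho>\<close> stand for \<open>\<alpha>/\<beta>\<close>, \<open>\<delta>/\<beta>\<close>, \<open>r/\<beta>\<close>.
  Subscripts are read from left to right, e.g. \<open>G\<^sub>t\<^sub>t\<^sub>s\<close> is \<open>pd_s S (pd_t S (pd_t S G))\<close>.
\<close>

definition D_op :: "(real \<times> real) set \<Rightarrow> real \<Rightarrow> real \<Rightarrow> real \<Rightarrow>
    (real \<times> real \<Rightarrow> complex) \<Rightarrow> real \<times> real \<Rightarrow> complex" where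
  "D_op S a d \<rho> G p = 1 / 3 *
     (3 * pd_s S (pd_t S (pd_t S G)) p - pd_t S (pd_t S (pd_t S G)) p
      - \<i> * of_real a * (2 * pd_s S (pd_t S G) p - pd_t S (pd_t S G) p)
      - of_real d * pd_t S G p + of_real \<rho> * G p)"

end

theory Submission
  imports Defs
begin

text \<open>
  Differentiating a double exponential generating function \<open>G(s,t) = \<Sum> b(m,n) s\<^sup>m t\<^sup>n / (m! n!)\<close>
  shifts its coefficients, so the linear equation with constant coefficients becomes a linear
  recurrence for \<open>b\<close>.  Solved for \<open>b(m+2,n+1)\<close>, it expresses column \<open>m + 2\<close> through the two
  previous columns, with bounded factors; hence \<open>b\<close> grows at most geometrically in \<open>m\<close>, uniformly
  in \<open>n\<close>.  The factorials then make \<open>G\<close> an entire function with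
  \<open>|G(s,t)| \<le> C exp (K (|s| + |t|))\<close>, which is smooth and may be differentiated termwise.
  The integral equation is the threefold integral of \<open>G\<^sub>s\<^sub>s\<^sub>t = DG\<close>.
\<close>

section \<open>Uniqueness of derivatives within convex sets\<close>

text \<open>A chord from \<open>x\<close> into \<open>S\<close> reduces to a one-variable derivative
  at the end of an interval, which is unique. A ball inside \<open>S\<close> then yields every
  direction as a multiple of a difference of two chords, even at a corner.\<close>

lemma has_derivative_unique_within_convex:
  fixes f :: "'a::real_normed_vector \<Rightarrow> 'b::real_normed_vector"
  assumes "convex S" "interior S \<noteq> {}" "x \<in> S"
    and f': "(f has_derivative f') (at x within S)"
    and f'': "(f has_derivative f'') (at x within S)"
  shows "f' = f''"
proof
  interpret f': bounded_linear f' using f' by (rule has_derivative_bounded_linear)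
  interpret f'': bounded_linear f'' using f'' by (rule has_derivative_bounded_linear)
  have chord: "f' (y - x) = f'' (y - x)" if "y \<in> S" for y
  proof -
    define l where "l u = x + u *\<^sub>R (y - x)" for u :: real
    have l: "(l has_derivative (\<lambda>u. u *\<^sub>R (y - x))) (at 0 within {0..1})"
      unfolding l_def by (auto intro!: derivative_eq_intros)
    have sub: "l ` {0..1} \<subseteq> S"
    proof clarify
      fix u :: real assume "u \<in> {0..1}"
      then have "(1 - u) *\<^sub>R x + u *\<^sub>R y \<in> S"
        using \<open>convex S\<close> \<open>x \<in> S\<close> \<open>y \<in> S\<close> by (auto intro: convexD)
      then show "l u \<in> S" by (simp add: l_def algebra_simps)
    qed
    have along: "((\<lambda>u. f (l u)) has_vector_derivative g (y - x)) (at 0 within {0..1})"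
      if g: "(f has_derivative g) (at x within S)" for g
    proof -
      interpret g: bounded_linear g using g by (rule has_derivative_bounded_linear)
      have "(f has_derivative g) (at (l 0) within l ` {0..1})"
        using has_derivative_subset[OF g sub] by (simp add: l_def)
      from has_derivative_in_compose[OF l this] show ?thesis
        by (simp add: has_vector_derivative_def g.scaleR)
    qed
    have "at (0::real) within {0..1} \<noteq> bot"
      by (simp add: trivial_limit_within islimpt_Icc)
    from vector_derivative_unique_within[OF this along[OF f'] along[OF f'']] show ?thesis .
  qed
  fix h :: 'a
  obtain z e where e: "e > 0" "cball z e \<subseteq> S"
    using \<open>interior S \<noteq> {}\<close> by (auto simp: mem_interior_cball)
  \<comment> \<open>The \<open>+ 1\<close> keeps the denominator positive for \<open>h = 0\<close>;
    the scaling places \<open>z + c *\<^sub>R h\<close> in the ball.\<close>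
  define c where "c = e / (norm h + 1)"
  have "c > 0" using e by (auto simp: c_def add_nonneg_pos)
  have "norm (c *\<^sub>R h) \<le> e"
  proof -
    have "norm (c *\<^sub>R h) = e * (norm h / (norm h + 1))"
      using e by (simp add: c_def add_nonneg_pos)
    also have "\<dots> \<le> e * 1" using e by (intro mult_left_mono) (auto simp: divide_le_eq_1 add_nonneg_pos)
    finally show ?thesis by simp
  qed
  then have "z + c *\<^sub>R h \<in> S" "z \<in> S" using e by (auto simp: dist_norm)
  from chord[OF this(1)] chord[OF this(2)] have "f' (c *\<^sub>R h) = f'' (c *\<^sub>R h)"
    by (simp add: f'.diff f''.diff f'.add f''.add diff_eq_eq)
  with \<open>c > 0\<close> show "f' h = f'' h" by (simp add: f'.scaleR f''.scaleR)
qed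

section \<open>Entire double exponential generating functions\<close>

text \<open>
  The part of total degree \<open>k\<close> of the generating function; grouping by degree turns the double series
  into a series over \<open>nat\<close>.
\<close>

definition hterm :: "(nat \<Rightarrow> nat \<Rightarrow> 'b::real_normed_vector) \<Rightarrow> nat \<Rightarrow> real \<times> real \<Rightarrow> 'b" where
  "hterm b k p = (\<Sum>i\<le>k. (fst p ^ i / fact i * (snd p ^ (k - i) / fact (k - i))) *\<^sub>R b i (k - i))"

definition egf :: "(nat \<Rightarrow> nat \<Rightarrow> 'b::real_normed_vector) \<Rightarrow> real \<times> real \<Rightarrow> 'b" where
  "egf b p = (\<Sum>k. hterm b k p)"

text \<open>This class is stable under both index shifts, hence under all partial derivatives, and
  the factorials in \<open>hterm\<close> turn it into convergence on the whole plane.\<close>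

definition geometric_growth :: "(nat \<Rightarrow> nat \<Rightarrow> 'b::real_normed_vector) \<Rightarrow> bool" where
  "geometric_growth b \<longleftrightarrow> (\<exists>C K. C \<ge> 0 \<and> K \<ge> 0 \<and> (\<forall>i j. norm (b i j) \<le> C * K ^ (i + j)))"

text \<open>Shifts correspond to partial derivatives. Both orders of composition beta-reduce to the
  same term, so mixed derivatives commute syntactically.\<close>

abbreviation (input) shift_s :: "(nat \<Rightarrow> nat \<Rightarrow> 'b) \<Rightarrow> nat \<Rightarrow> nat \<Rightarrow> 'b" where
  "shift_s b \<equiv> \<lambda>i j. b (Suc i) j"

abbreviation (input) shift_t :: "(nat \<Rightarrow> nat \<Rightarrow> 'b) \<Rightarrow> nat \<Rightarrow> nat \<Rightarrow> 'b" where
  "shift_t b \<equiv> \<lambda>i j. b i (Suc j)"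

lemma geometric_growth_shift:
  assumes "geometric_growth b"
  shows "geometric_growth (shift_s b)" "geometric_growth (shift_t b)"
proof -
  obtain C K where "C \<ge> 0" "K \<ge> 0" and b: "\<And>i j. norm (b i j) \<le> C * K ^ (i + j)"
    using assms unfolding geometric_growth_def by blast
  then show "geometric_growth (shift_s b)" "geometric_growth (shift_t b)"
    unfolding geometric_growth_def
    using b[of "Suc i" j for i j] b[of i "Suc j" for i j]
    by - (rule exI[of _ "C * K"], rule exI[of _ K], simp add: mult.assoc)+
qed

text \<open>After factoring out \<open>1 / fact k\<close>, the weights are binomial coefficients,
  and the binomial theorem leaves a term of an exponential series.\<close>

lemma norm_hterm_le:
  assumes "K \<ge> 0" and b: "\<And>i j. norm (b i j) \<le> C * K ^ (i + j)"
  shows "norm (hterm b k p) \<le> C * ((K * (\<bar>fst p\<bar> + \<bar>snd p\<bar>)) ^ k / fact k)"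
proof -
  have "norm (hterm b k p) \<le>
      (\<Sum>i\<le>k. (\<bar>fst p\<bar> ^ i / fact i * (\<bar>snd p\<bar> ^ (k - i) / fact (k - i))) * (C * K ^ k))"
    unfolding hterm_def
  proof (rule sum_norm_le)
    fix i assume "i \<in> {..k}"
    then show "norm ((fst p ^ i / fact i * (snd p ^ (k - i) / fact (k - i))) *\<^sub>R b i (k - i))
        \<le> (\<bar>fst p\<bar> ^ i / fact i * (\<bar>snd p\<bar> ^ (k - i) / fact (k - i))) * (C * K ^ k)"
      using b[of i "k - i"] by (auto simp: abs_mult power_abs intro!: mult_left_mono divide_right_mono)
  qed
  also have "\<dots> = (\<Sum>i\<le>k. of_nat (k choose i) * \<bar>fst p\<bar> ^ i * \<bar>snd p\<bar> ^ (k - i)) * (C * K ^ k) / fact k"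
    unfolding sum_distrib_right sum_divide_distrib
    by (intro sum.cong refl) (simp add: binomial_fact field_simps)
  also have "\<dots> = C * ((K * (\<bar>fst p\<bar> + \<bar>snd p\<bar>)) ^ k / fact k)"
    by (simp add: binomial_ring[symmetric] power_mult_distrib)
  finally show ?thesis .
qed

lemma uniform_limit_egf:
  fixes b :: "nat \<Rightarrow> nat \<Rightarrow> 'b::banach"
  assumes "geometric_growth b"
  shows "uniform_limit (cball 0 R) (\<lambda>n p. \<Sum>k<n. hterm b k p) (egf b) sequentially"
proof -
  obtain C K where CK: "C \<ge> 0" "K \<ge> 0" and b: "\<And>i j. norm (b i j) \<le> C * K ^ (i + j)"
    using assms unfolding geometric_growth_def by blast
  show ?thesis
    unfolding egf_def
  proof (rule Weierstrass_m_test)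
    \<comment> \<open>On the ball each coordinate is at most \<open>R\<close> in absolute value, so
      \<open>2 * R\<close> bounds their sum; the majorants form an exponential series.\<close>
    show "summable (\<lambda>k. C * ((K * (2 * R)) ^ k / fact k))"
      using summable_exp[of "K * (2 * R)"] by (intro summable_mult) (simp add: field_simps)
    fix k p assume p: "p \<in> cball (0 :: real \<times> real) R"
    have "\<bar>fst p\<bar> + \<bar>snd p\<bar> \<le> 2 * R"
      using p norm_fst_le[of "fst p" "snd p"] norm_snd_le[of "snd p" "fst p"] by simp
    then have "C * ((K * (\<bar>fst p\<bar> + \<bar>snd p\<bar>)) ^ k / fact k) \<le> C * ((K * (2 * R)) ^ k / fact k)"
      using CK by (intro mult_left_mono divide_right_mono power_mono) auto
    with norm_hterm_le[OF CK(2) b, of k p]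
    show "norm (hterm b k p) \<le> C * ((K * (2 * R)) ^ k / fact k)" by linarith
  qed
qed

lemma hterm_sums_egf:
  fixes b :: "nat \<Rightarrow> nat \<Rightarrow> 'b::banach"
  assumes "geometric_growth b"
  shows "(\<lambda>k. hterm b k p) sums egf b p"
  unfolding sums_def
  using tendsto_uniform_limitI[OF uniform_limit_egf[OF assms, of "norm p"], of p] by simp

lemma has_real_derivative_power_div_fact:
  "((\<lambda>x. x ^ Suc n / fact (Suc n)) has_real_derivative x ^ n / fact n) (at x within S)"
proof -
  have "((\<lambda>x. x ^ Suc n / fact (Suc n)) has_real_derivative
      (real (Suc n) * x ^ n) / fact (Suc n)) (at x within S)"
    using DERIV_cdivide[OF DERIV_power_Suc[OF DERIV_ident], of n "fact (Suc n)" x S] by simp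
  then show ?thesis by (simp add: field_simps del: of_nat_Suc)
qed

lemma has_derivative_hterm:
  "(hterm b (Suc k) has_derivative
     (\<lambda>h. fst h *\<^sub>R hterm (shift_s b) k p + snd h *\<^sub>R hterm (shift_t b) k p)) (at p within S)"
proof -
  define e where "e n x = x ^ n / fact n" for n and x :: real
  \<comment> \<open>The separate case \<open>n = 0\<close> avoids truncated subtraction, which would
    give 1 rather than the derivative 0 of a constant.\<close>
  define e' where "e' n x = (if n = 0 then 0 else e (n - 1) x)" for n and x :: real
  have e: "(e n has_real_derivative e' n x) (at x)" for n x
    using has_real_derivative_power_div_fact[of "n - 1" x UNIV]
    by (cases n) (auto simp: e_def[abs_def] e'_def)
  have fst: "((\<lambda>p. e n (fst p)) has_derivative (\<lambda>h. fst h * e' n (fst p))) (at p within S)" for n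
    using has_derivative_compose[OF has_derivative_fst[OF has_derivative_ident]
        e[unfolded has_field_derivative_def]] by (simp add: mult.commute)
  have snd: "((\<lambda>p. e n (snd p)) has_derivative (\<lambda>h. snd h * e' n (snd p))) (at p within S)" for n
    using has_derivative_compose[OF has_derivative_snd[OF has_derivative_ident]
        e[unfolded has_field_derivative_def]] by (simp add: mult.commute)
  have "(hterm b (Suc k) has_derivative (\<lambda>h. \<Sum>i\<le>Suc k.
      (e i (fst p) * (snd h * e' (Suc k - i) (snd p)) + fst h * e' i (fst p) * e (Suc k - i) (snd p))
      *\<^sub>R b i (Suc k - i))) (at p within S)"
    unfolding hterm_def[abs_def] e_def[symmetric]
    by (intro has_derivative_sum has_derivative_scaleR_left has_derivative_mult fst snd)
  also have "(\<lambda>h. \<Sum>i\<le>Suc k.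
      (e i (fst p) * (snd h * e' (Suc k - i) (snd p)) + fst h * e' i (fst p) * e (Suc k - i) (snd p))
      *\<^sub>R b i (Suc k - i)) =
    (\<lambda>h. (\<Sum>i\<le>Suc k. (snd h * (e i (fst p) * e' (Suc k - i) (snd p))) *\<^sub>R b i (Suc k - i)) +
         (\<Sum>i\<le>Suc k. (fst h * (e' i (fst p) * e (Suc k - i) (snd p))) *\<^sub>R b i (Suc k - i)))"
    by (simp only: scaleR_add_left sum.distrib mult.assoc mult.left_commute)
  also have "\<dots> = (\<lambda>h. snd h *\<^sub>R hterm (shift_t b) k p + fst h *\<^sub>R hterm (shift_s b) k p)"
  proof (intro ext arg_cong2[of _ _ _ _ "(+)"])
    fix h :: "real \<times> real"
    show "(\<Sum>i\<le>Suc k. (snd h * (e i (fst p) * e' (Suc k - i) (snd p))) *\<^sub>R b i (Suc k - i))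
        = snd h *\<^sub>R hterm (shift_t b) k p"
      by (auto simp: hterm_def scaleR_sum_right e'_def e_def Suc_diff_le intro!: sum.cong)
    show "(\<Sum>i\<le>Suc k. (fst h * (e' i (fst p) * e (Suc k - i) (snd p))) *\<^sub>R b i (Suc k - i))
        = fst h *\<^sub>R hterm (shift_s b) k p"
      \<comment> \<open>Here the term \<open>i = 0\<close> vanishes and the others are reindexed; in
        the sum for the other variable it was the top term \<open>i = Suc k\<close> that
        vanished.\<close>
      unfolding sum.atMost_Suc_shift
      by (auto simp: hterm_def scaleR_sum_right e'_def e_def intro!: sum.cong)
  qed
  finally show ?thesis by (simp add: add.commute)
qed

text \<open>Termwise differentiation is legitimate because both shifted series converge uniformly on
  a ball with \<open>p\<close> in its interior.\<close>

lemma has_derivative_egf: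
  fixes b :: "nat \<Rightarrow> nat \<Rightarrow> 'b::banach"
  assumes "geometric_growth b"
  shows "(egf b has_derivative (\<lambda>h. fst h *\<^sub>R egf (shift_s b) p + snd h *\<^sub>R egf (shift_t b) p)) (at p)"
proof -
  define B :: "(real \<times> real) set" where "B = cball 0 (norm p + 1)"
  define f' where "f' n q h = (case n of 0 \<Rightarrow> 0
    | Suc k \<Rightarrow> fst h *\<^sub>R hterm (shift_s b) k q + snd h *\<^sub>R hterm (shift_t b) k q)"
    for n and q h :: "real \<times> real"
  define g' where "g' q h = fst h *\<^sub>R egf (shift_s b) q + snd h *\<^sub>R egf (shift_t b) q"
    for q h :: "real \<times> real"
  have p: "p \<in> interior B"
    by (simp add: B_def dist_norm)
  then have "p \<in> B" using interior_subset by blast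
  have f': "(hterm b n has_derivative f' n q) (at q within B)" for n q
  proof (cases n)
    case 0
    have "hterm b 0 = (\<lambda>_. b 0 0)" by (simp add: hterm_def fun_eq_iff)
    with 0 show ?thesis by (simp add: f'_def[abs_def])
  qed (simp add: f'_def[abs_def] has_derivative_hterm)
  have lim: "\<forall>\<^sub>F n in sequentially. \<forall>q\<in>B. \<forall>h. norm ((\<Sum>i<n. f' i q h) - g' q h) \<le> e * norm h"
    if "e > 0" for e
  proof -
    have "\<forall>\<^sub>F n in sequentially. \<forall>q\<in>B. dist (\<Sum>k<n. hterm c k q) (egf c q) < e / 2"
      if "geometric_growth c" for c :: "nat \<Rightarrow> nat \<Rightarrow> 'b"
      unfolding B_def
      by (rule uniform_limitD[OF uniform_limit_egf[OF that]]) (use \<open>e > 0\<close> in simp)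
    note this[OF geometric_growth_shift(1)[OF assms]] this[OF geometric_growth_shift(2)[OF assms]]
    \<comment> \<open>Degree \<open>Suc k\<close> differentiates to degree \<open>k\<close>, and
      degree 0 to zero, so \<open>Suc n\<close> terms of the derivative match \<open>n\<close> terms
      of the shifted series.\<close>
    then have "\<forall>\<^sub>F n in sequentially. \<forall>q\<in>B. \<forall>h. norm ((\<Sum>i<Suc n. f' i q h) - g' q h) \<le> e * norm h"
    proof eventually_elim
      case (elim n)
      show ?case
      proof (intro ballI allI)
        fix q h assume "q \<in> B"
        let ?s = "(\<Sum>k<n. hterm (shift_s b) k q) - egf (shift_s b) q"
        let ?t = "(\<Sum>k<n. hterm (shift_t b) k q) - egf (shift_t b) q"
        have "(\<Sum>i<Suc n. f' i q h) - g' q h = fst h *\<^sub>R ?s + snd h *\<^sub>R ?t"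
          unfolding sum.lessThan_Suc_shift
          by (simp add: f'_def g'_def sum.distrib scaleR_sum_right scaleR_right_diff_distrib)
        then have "norm ((\<Sum>i<Suc n. f' i q h) - g' q h) = norm (fst h *\<^sub>R ?s + snd h *\<^sub>R ?t)"
          by (simp only:)
        also have "\<dots> \<le> \<bar>fst h\<bar> * norm ?s + \<bar>snd h\<bar> * norm ?t"
          by (rule order_trans[OF norm_triangle_ineq]) simp
        also have "\<dots> \<le> norm h * (e / 2) + norm h * (e / 2)"
        proof (intro add_mono mult_mono)
          show "\<bar>fst h\<bar> \<le> norm h" "\<bar>snd h\<bar> \<le> norm h"
            using norm_fst_le[of "fst h" "snd h"] norm_snd_le[of "snd h" "fst h"] by simp_all
          show "norm ?s \<le> e / 2" "norm ?t \<le> e / 2"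
            using elim \<open>q \<in> B\<close> by (simp_all add: dist_norm less_imp_le)
        qed simp_all
        also have "\<dots> = e * norm h" by simp
        finally show "norm ((\<Sum>i<Suc n. f' i q h) - g' q h) \<le> e * norm h" .
      qed
    qed
    then show ?thesis
      by (rule eventually_sequentially_Suc[THEN iffD1])
  qed
  \<comment> \<open>Termwise differentiation provides some limit \<open>g\<close>; uniqueness of
    sums then identifies it with \<open>egf b\<close> on \<open>B\<close>.\<close>
  have "\<exists>g. \<forall>q\<in>B. (\<lambda>n. hterm b n q) sums g q \<and> (g has_derivative g' q) (at q within B)"
    by (rule has_derivative_series[OF _ f' lim \<open>p \<in> B\<close> hterm_sums_egf[OF assms]]) (simp add: B_def)
  then obtain g where g: "\<And>q. q \<in> B \<Longrightarrow> (\<lambda>n. hterm b n q) sums g q"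
      "\<And>q. q \<in> B \<Longrightarrow> (g has_derivative g' q) (at q within B)" by blast
  have "g q = egf b q" if "q \<in> B" for q
    using sums_unique2[OF g(1)[OF that] hterm_sums_egf[OF assms]] .
  then have "(egf b has_derivative g' p) (at p within B)"
    by (intro has_derivative_transform[OF \<open>p \<in> B\<close> _ g(2)[OF \<open>p \<in> B\<close>]]) simp
  then show ?thesis
    using at_within_interior[OF p] by (simp add: g'_def[abs_def])
qed

section \<open>The coefficient recurrence and its growth\<close>

text \<open>
  The Taylor coefficients at the origin, scaled by \<open>m! n!\<close>: the first clauses encode
  \<open>G(0,t) = 0\<close>, \<open>G\<^sub>s(0,t) = -\<rho>t/3\<close> and \<open>G(s,0) = 0\<close>, the last one the equation
  solved for \<open>G\<^sub>s\<^sub>s\<^sub>t\<close>.  Every term on its right-hand side has a lower index in \<open>s\<close>.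
\<close>

fun goursat_coeff :: "real \<Rightarrow> real \<Rightarrow> real \<Rightarrow> nat \<Rightarrow> nat \<Rightarrow> complex" where
  "goursat_coeff a d \<rho> 0 n = 0"
| "goursat_coeff a d \<rho> (Suc 0) n = (if n = 1 then - of_real (\<rho> / 3) else 0)"
| "goursat_coeff a d \<rho> (Suc (Suc m)) 0 = 0"
| "goursat_coeff a d \<rho> (Suc (Suc m)) (Suc n) =
     goursat_coeff a d \<rho> (Suc m) (Suc (Suc n)) -
     (goursat_coeff a d \<rho> m (Suc (Suc (Suc n)))
      + \<i> * of_real a * (2 * goursat_coeff a d \<rho> (Suc m) (Suc n) - goursat_coeff a d \<rho> m (Suc (Suc n)))
      + of_real d * goursat_coeff a d \<rho> m (Suc n) - of_real \<rho> * goursat_coeff a d \<rho> m n) / 3"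

text \<open>The recurrence raises the second index, so the bound is kept uniform in
  \<open>n\<close>: with \<open>K ^ (m + n)\<close> the leading terms on both sides would carry the
  same power, leaving no gain to absorb their factors. The factor \<open>\<bar>\<rho>\<bar>\<close>
  comes from the single nonzero initial coefficient.\<close>

lemma norm_goursat_coeff_le:
  "norm (goursat_coeff a d \<rho> m n) \<le> \<bar>\<rho>\<bar> * (2 + \<bar>a\<bar> + \<bar>d\<bar> + \<bar>\<rho>\<bar>) ^ m"
proof (induction a d \<rho> m n rule: goursat_coeff.induct)
  case (2 a d \<rho> n)
  have "\<bar>\<rho>\<bar> / 3 \<le> \<bar>\<rho>\<bar> * (2 + \<bar>a\<bar> + \<bar>d\<bar> + \<bar>\<rho>\<bar>)"
    by (simp add: field_simps add_nonneg_nonneg)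
  then show ?case by (simp add: norm_divide)
next
  case (4 a d \<rho> m n)
  \<comment> \<open>Chosen to dominate \<open>4 / 3 + \<bar>a\<bar> + \<bar>d\<bar> / 3 +
    \<bar>\<rho>\<bar> / 3\<close>, the total weight of the recurrence once every \<open>X\<close>
    is enlarged to \<open>K * X\<close>.\<close>
  define K where "K = 2 + \<bar>a\<bar> + \<bar>d\<bar> + \<bar>\<rho>\<bar>"
  define X where "X = \<bar>\<rho>\<bar> * K ^ m"
  have K: "K \<ge> 1" and X: "X \<ge> 0" by (auto simp: K_def X_def)
  let ?b = "goursat_coeff a d \<rho>"
  have IH: "norm (?b (Suc m) (Suc (Suc n))) \<le> K * X" "norm (?b m (Suc (Suc (Suc n)))) \<le> X"
    "norm (?b (Suc m) (Suc n)) \<le> K * X" "norm (?b m (Suc (Suc n))) \<le> X"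
    "norm (?b m (Suc n)) \<le> X" "norm (?b m n) \<le> X"
    by (fact 4[folded K_def, unfolded power_Suc mult.left_commute[of "\<bar>\<rho>\<bar>" K], folded X_def])+
  have "norm (?b (Suc (Suc m)) (Suc n)) \<le> norm (?b (Suc m) (Suc (Suc n))) +
      (norm (?b m (Suc (Suc (Suc n))))
       + \<bar>a\<bar> * (2 * norm (?b (Suc m) (Suc n)) + norm (?b m (Suc (Suc n))))
       + \<bar>d\<bar> * norm (?b m (Suc n)) + \<bar>\<rho>\<bar> * norm (?b m n)) / 3"
  proof -
    have "norm (x - (y + \<i> * of_real a * (2 * z - u) + of_real d * v - of_real \<rho> * w) / 3)
        \<le> norm x + (norm y + \<bar>a\<bar> * (2 * norm z + norm u) + \<bar>d\<bar> * norm v + \<bar>\<rho>\<bar> * norm w) / 3"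
      for x y z u v w :: complex
    proof -
      let ?y = "y + \<i> * of_real a * (2 * z - u) + of_real d * v - of_real \<rho> * w"
      have "norm (x - ?y / 3) \<le> norm x + norm ?y / 3"
        using norm_triangle_ineq4[of x "?y / 3"] by (simp add: norm_divide)
      also have "norm ?y \<le> norm y + norm (\<i> * of_real a * (2 * z - u))
          + norm (of_real d * v) + norm (of_real \<rho> * w)"
        by norm
      also have "\<dots> \<le> norm y + \<bar>a\<bar> * (2 * norm z + norm u) + \<bar>d\<bar> * norm v + \<bar>\<rho>\<bar> * norm w"
        using norm_triangle_ineq4[of "2 * z" u]
        by (intro add_mono) (auto simp: norm_mult intro!: mult_left_mono)
      finally show ?thesis by simp
    qed
    then show ?thesis by simp
  qed
  also have "\<dots> \<le> K * X + (X + \<bar>a\<bar> * (2 * (K * X) + X) + \<bar>d\<bar> * X + \<bar>\<rho>\<bar> * X) / 3"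
    using IH by (intro add_mono divide_right_mono mult_left_mono) auto
  also have "\<dots> \<le> K * X + (K * X + \<bar>a\<bar> * (2 * (K * X) + K * X) + \<bar>d\<bar> * (K * X) + \<bar>\<rho>\<bar> * (K * X)) / 3"
    using mult_right_mono[OF K X] K
    by (intro add_mono divide_right_mono mult_left_mono) auto
  also have "\<dots> = (4 / 3 + \<bar>a\<bar> + \<bar>d\<bar> / 3 + \<bar>\<rho>\<bar> / 3) * (K * X)"
    by (simp add: field_simps)
  also have "\<dots> \<le> K * (K * X)"
    using K X by (intro mult_right_mono) (auto simp: K_def)
  finally show ?case
    unfolding K_def[symmetric] X_def power_Suc by (simp only: mult.left_commute[of "\<bar>\<rho>\<bar>" K])
qed auto

lemma geometric_growth_goursat_coeff: "geometric_growth (goursat_coeff a d \<rho>)"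
proof -
  define K where "K = 2 + \<bar>a\<bar> + \<bar>d\<bar> + \<bar>\<rho>\<bar>"
  have "norm (goursat_coeff a d \<rho> i j) \<le> \<bar>\<rho>\<bar> * K ^ (i + j)" for i j
  proof -
    have "K ^ i \<le> K ^ (i + j)" by (rule power_increasing) (auto simp: K_def)
    with norm_goursat_coeff_le[of a d \<rho> i j] show ?thesis
      unfolding K_def[symmetric] by (meson abs_ge_zero mult_left_mono order_trans)
  qed
  then show ?thesis
    unfolding geometric_growth_def by (intro exI[of _ "\<bar>\<rho>\<bar>"] exI[of _ K]) (auto simp: K_def)
qed

section \<open>Axis values and the differential equation\<close>

text \<open>At \<open>s = 0\<close> only column 0 survives, since \<open>0 ^ 0 = 1\<close>. A single
  monomial covers all the axis data used later.\<close>

lemma egf_on_t_axis: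
  fixes b :: "nat \<Rightarrow> nat \<Rightarrow> 'b::banach"
  assumes "\<And>j. b 0 j = (if j = n then c else 0)"
  shows "egf b (0, t) = (t ^ n / fact n) *\<^sub>R c"
proof -
  have "hterm b k (0, t) = (if k = n then (t ^ n / fact n) *\<^sub>R c else 0)" for k
  proof -
    have "hterm b k (0, t) = (\<Sum>i\<in>{0}. (0 ^ i / fact i * (t ^ (k - i) / fact (k - i))) *\<^sub>R b i (k - i))"
      unfolding hterm_def by (rule sum.mono_neutral_cong_right) auto
    then show ?thesis by (simp add: assms)
  qed
  then show ?thesis
    using sums_single[of n "\<lambda>_. (t ^ n / fact n) *\<^sub>R c"] by (simp add: egf_def sums_iff eq_commute)
qed

lemma egf_on_s_axis:
  assumes "\<And>i. b i 0 = 0"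
  shows "egf b (s, 0) = 0"
proof -
  \<comment> \<open>Each summand either carries a positive power of \<open>t = 0\<close> or has a
    coefficient \<open>b i 0\<close>.\<close>
  have "0 ^ (k - i) = (0::real) \<or> b i (k - i) = 0" for k i
    using assms by (cases "k - i") auto
  then have "hterm b k (s, 0) = 0" for k
    unfolding hterm_def snd_conv by (intro sum.neutral ballI) auto
  then show ?thesis by (simp add: egf_def)
qed

text \<open>Combined degree by degree, the coefficient in each summand is three times the last
  clause of \<open>goursat_coeff\<close> with all terms on one side.\<close>

lemma egf_goursat_pde:
  fixes a d \<rho> :: real
  defines "b \<equiv> goursat_coeff a d \<rho>"
  shows "3 * egf (shift_t (shift_s (shift_s b))) p - 3 * egf (shift_s (shift_t (shift_t b))) p
    + egf (shift_t (shift_t (shift_t b))) p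
    + \<i> * of_real a * (2 * egf (shift_s (shift_t b)) p - egf (shift_t (shift_t b)) p)
    + of_real d * egf (shift_t b) p - of_real \<rho> * egf b p = 0"
proof (rule sums_unique2[OF _ sums_zero])
  have b: "geometric_growth b" by (simp add: b_def geometric_growth_goursat_coeff)
  let ?H = "\<lambda>k. 3 * hterm (shift_t (shift_s (shift_s b))) k p - 3 * hterm (shift_s (shift_t (shift_t b))) k p
    + hterm (shift_t (shift_t (shift_t b))) k p
    + \<i> * of_real a * (2 * hterm (shift_s (shift_t b)) k p - hterm (shift_t (shift_t b)) k p)
    + of_real d * hterm (shift_t b) k p - of_real \<rho> * hterm b k p"
  have "?H k = 0" for k
  proof -
    have "?H k = (\<Sum>i\<le>k. (fst p ^ i / fact i * (snd p ^ (k - i) / fact (k - i))) *\<^sub>R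
      (3 * b (Suc (Suc i)) (Suc (k - i)) - 3 * b (Suc i) (Suc (Suc (k - i))) + b i (Suc (Suc (Suc (k - i))))
       + \<i> * of_real a * (2 * b (Suc i) (Suc (k - i)) - b i (Suc (Suc (k - i))))
       + of_real d * b i (Suc (k - i)) - of_real \<rho> * b i (k - i)))"
      by (simp only: hterm_def scaleR_add_right scaleR_diff_right sum.distrib sum_subtractf
          right_diff_distrib mult_scaleR_right[symmetric] sum_distrib_left[symmetric])
    also have "\<dots> = 0"
      by (intro sum.neutral ballI) (simp add: b_def field_simps)
    finally show ?thesis .
  qed
  moreover have "?H sums (3 * egf (shift_t (shift_s (shift_s b))) p - 3 * egf (shift_s (shift_t (shift_t b))) p
    + egf (shift_t (shift_t (shift_t b))) p
    + \<i> * of_real a * (2 * egf (shift_s (shift_t b)) p - egf (shift_t (shift_t b)) p)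
    + of_real d * egf (shift_t b) p - of_real \<rho> * egf b p)"
    by (intro sums_add sums_diff sums_mult hterm_sums_egf geometric_growth_shift b)
  ultimately show "(\<lambda>_. 0) sums \<dots>"
    by (simp only:)
qed

section \<open>Smoothness and partial derivatives on convex sets\<close>

text \<open>\<open>frechet_derivative\<close> chooses some derivative, which uniqueness within
  \<open>S\<close> identifies. Agreement with \<open>egf b\<close> is assumed only on
  \<open>S\<close>, so the result can be iterated: each derivative is again known on
  \<open>S\<close>.\<close>

lemma dir_deriv_egf:
  fixes b :: "nat \<Rightarrow> nat \<Rightarrow> 'b::banach"
  assumes S: "convex S" "interior S \<noteq> {}" and "geometric_growth b"
    and eq: "\<And>q. q \<in> S \<Longrightarrow> f q = egf b q" and "p \<in> S"
  shows "f differentiable at p within S"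
    and "dir_deriv S v f p = fst v *\<^sub>R egf (shift_s b) p + snd v *\<^sub>R egf (shift_t b) p"
proof -
  let ?f' = "\<lambda>h. fst h *\<^sub>R egf (shift_s b) p + snd h *\<^sub>R egf (shift_t b) p"
  have f': "(f has_derivative ?f') (at p within S)"
    using has_derivative_transform[OF \<open>p \<in> S\<close> eq
        has_derivative_at_withinI[OF has_derivative_egf[OF assms(3)]]] .
  then show diff: "f differentiable at p within S"
    by (rule differentiableI)
  show "dir_deriv S v f p = fst v *\<^sub>R egf (shift_s b) p + snd v *\<^sub>R egf (shift_t b) p"
    unfolding dir_deriv_def
    using has_derivative_unique_within_convex[OF S \<open>p \<in> S\<close>
        diff[unfolded frechet_derivative_works] f'] by simp
qed

lemma smooth_on_egf:
  fixes b :: "nat \<Rightarrow> nat \<Rightarrow> 'b::banach"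
  assumes S: "convex S" "interior S \<noteq> {}" and "geometric_growth b"
  shows "smooth_on S (egf b)"
proof -
  \<comment> \<open>The induction covers all functions agreeing on \<open>S\<close> with a
    generating function of geometric growth, a class closed under \<open>dir_deriv S v\<close> for
    basis vectors \<open>v\<close>.\<close>
  have "fold (dir_deriv S) vs f differentiable_on S"
    if "set vs \<subseteq> Basis" "geometric_growth c" "\<And>q. q \<in> S \<Longrightarrow> f q = egf c q"
    for vs and f :: "real \<times> real \<Rightarrow> 'b" and c
    using that
  proof (induction vs arbitrary: f c)
    case Nil
    then show ?case by (auto simp: differentiable_on_def intro: dir_deriv_egf(1)[OF S])
  next
    case (Cons v vs)
    then have "v = (1, 0) \<or> v = (0, 1)" by (auto simp: Basis_prod_def)
    then have "\<exists>c'. geometric_growth c' \<and> (\<forall>q\<in>S. dir_deriv S v f q = egf c' q)"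
    proof
      assume "v = (1, 0)"
      then show ?thesis
        using geometric_growth_shift(1)[OF Cons.prems(2)] dir_deriv_egf(2)[OF S Cons.prems(2,3)]
        by (intro exI[of _ "shift_s c"]) simp
    next
      assume "v = (0, 1)"
      then show ?thesis
        using geometric_growth_shift(2)[OF Cons.prems(2)] dir_deriv_egf(2)[OF S Cons.prems(2,3)]
        by (intro exI[of _ "shift_t c"]) simp
    qed
    with Cons.IH Cons.prems(1) show ?case by auto
  qed
  with assms show ?thesis by (auto simp: smooth_on_def)
qed

lemma pd_egf:
  assumes S: "convex S" "interior S \<noteq> {}" and b: "geometric_growth b"
    and f: "\<And>q. q \<in> S \<Longrightarrow> f q = egf b q" and "p \<in> S"
  shows "pd_s S f p = egf (shift_s b) p" "pd_t S f p = egf (shift_t b) p"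
  using dir_deriv_egf(2)[OF S b f \<open>p \<in> S\<close>] by (simp_all add: pd_s_def pd_t_def)

section \<open>Integration in each variable\<close>

lemma has_integral_egf_shift_s:
  fixes b :: "nat \<Rightarrow> nat \<Rightarrow> 'b::banach"
  assumes "geometric_growth b" "s \<ge> 0"
  shows "((\<lambda>x. egf (shift_s b) (x, t)) has_integral egf b (s, t) - egf b (0, t)) {0..s}"
proof (rule fundamental_theorem_of_calculus[OF \<open>s \<ge> 0\<close>])
  fix x
  have "((\<lambda>x. (x, t)) has_derivative (\<lambda>h. (h, 0))) (at x within {0..s})"
    by (auto intro!: derivative_eq_intros)
  from has_derivative_compose[OF this has_derivative_egf[OF assms(1)]]
  show "((\<lambda>x. egf b (x, t)) has_vector_derivative egf (shift_s b) (x, t)) (at x within {0..s})"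
    by (simp add: has_vector_derivative_def)
qed

lemma has_integral_egf_shift_t:
  fixes b :: "nat \<Rightarrow> nat \<Rightarrow> 'b::banach"
  assumes "geometric_growth b" "t \<ge> 0"
  shows "((\<lambda>y. egf (shift_t b) (s, y)) has_integral egf b (s, t) - egf b (s, 0)) {0..t}"
proof (rule fundamental_theorem_of_calculus[OF \<open>t \<ge> 0\<close>])
  fix y
  have "((\<lambda>y. (s, y)) has_derivative (\<lambda>h. (0, h))) (at y within {0..t})"
    by (auto intro!: derivative_eq_intros)
  from has_derivative_compose[OF this has_derivative_egf[OF assms(1)]]
  show "((\<lambda>y. egf b (s, y)) has_vector_derivative egf (shift_t b) (s, y)) (at y within {0..t})"
    by (simp add: has_vector_derivative_def)
qed

section \<open>Geometry of the triangle\<close>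

lemma Delta_eq_halfspaces:
  "Delta L = {p. 0 < (1, 0) \<bullet> p} \<inter> {p. 0 < (0, 1) \<bullet> p} \<inter> {p. (1, 1) \<bullet> p < L}"
  by (auto simp: Delta_def)

lemma convex_Delta: "convex (Delta L)"
  by (simp add: Delta_eq_halfspaces convex_Int convex_halfspace_gt convex_halfspace_lt)

lemma open_Delta: "open (Delta L)"
  by (simp add: Delta_eq_halfspaces open_Int open_halfspace_gt open_halfspace_lt)

text \<open>Points on the two legs are included because boundary conditions and integration paths
  meet them.\<close>

lemma mem_closure_Delta:
  assumes "0 \<le> s" "0 \<le> t" "s + t < L"
  shows "(s, t) \<in> closure (Delta L)"
proof -
  \<comment> \<open>Moving both coordinates up by at most a third of the slack makes them positive
    and keeps their sum below \<open>L\<close>.\<close>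
  define e where "e n = (L - s - t) / 3 / real (Suc n)" for n
  have "(\<lambda>n. (s + e n, t + e n)) \<longlonglongrightarrow> (s + 0, t + 0)"
    unfolding e_def by (intro tendsto_intros LIMSEQ_Suc[OF lim_const_over_n])
  moreover have "(s + e n, t + e n) \<in> Delta L" for n
  proof -
    have "e n > 0" using assms by (simp add: e_def)
    moreover have "e n \<le> (L - s - t) / 3"
      using assms divide_left_mono[of 1 "real (Suc n)" "(L - s - t) / 3"] by (simp add: e_def)
    ultimately show ?thesis using assms by (auto simp: Delta_def)
  qed
  ultimately show ?thesis unfolding closure_sequential by force
qed

section \<open>Construction of the solution\<close>

theorem lemma2p1:
  fixes L \<alpha> \<beta> \<delta> r :: real
  assumes "L > 0" and "\<beta> > 0" and "r > 0"
  shows "let a = \<alpha> / \<beta>; d = \<delta> / \<beta>; \<rho> = r / \<beta>; T = closure (Delta L) in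
    \<exists>G :: real \<times> real \<Rightarrow> complex.
      smooth_on T G \<and>
      (\<forall>(s, t) \<in> Delta L.
         G (s, t) = - of_real (\<rho> / 3 * s * t)
           + integral {0..t} (\<lambda>\<eta>. integral {0..s} (\<lambda>\<omega>. integral {0..\<omega>} (\<lambda>\<xi>.
               D_op T a d \<rho> G (\<xi>, \<eta>))))) \<and>
      (\<forall>p \<in> Delta L.
         3 * pd_t T (pd_s T (pd_s T G)) p - 3 * pd_s T (pd_t T (pd_t T G)) p
         + pd_t T (pd_t T (pd_t T G)) p
         + \<i> * of_real a * (2 * pd_s T (pd_t T G) p - pd_t T (pd_t T G) p)
         + of_real d * pd_t T G p - of_real \<rho> * G p = 0) \<and>
      (\<forall>t \<in> {0<..<L}. G (0, t) = 0) \<and>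
      (\<forall>s \<in> {0<..<L}. G (s, 0) = 0) \<and>
      (\<forall>t \<in> {0<..<L}. pd_s T G (0, t) = - of_real (\<rho> * t / 3))"
proof -
  define a d \<rho> T where "a = \<alpha> / \<beta>" and "d = \<delta> / \<beta>" and "\<rho> = r / \<beta>" and "T = closure (Delta L)"
  define b where "b = goursat_coeff a d \<rho>"
  define G where "G = egf b"
  have b: "geometric_growth b"
    by (simp add: b_def geometric_growth_goursat_coeff)
  note growth = b geometric_growth_shift

  \<comment> \<open>A point of the open triangle gives \<open>T\<close> nonempty interior, so
    derivatives within \<open>T\<close> are unique up to the boundary.\<close>
  have "(L / 3, L / 3) \<in> Delta L" using \<open>L > 0\<close> by (simp add: Delta_def)
  moreover have "Delta L \<subseteq> interior T"
    unfolding T_def by (rule interior_maximal[OF closure_subset open_Delta])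
  ultimately have T: "convex T" "interior T \<noteq> {}"
    by (auto simp: T_def convex_closure convex_Delta)
  have sub: "Delta L \<subseteq> T" by (simp add: T_def closure_subset)
  note pd = pd_egf[OF T]

  have G_s: "pd_s T G p = egf (shift_s b) p" and G_t: "pd_t T G p = egf (shift_t b) p" if "p \<in> T" for p
    using pd[OF b _ that, of G] by (simp_all add: G_def)
  \<comment> \<open>Higher partials are obtained in stages, each from a function already identified
    on all of \<open>T\<close>.\<close>
  have G_ss: "pd_s T (pd_s T G) p = egf (shift_s (shift_s b)) p"
    and G_ts: "pd_s T (pd_t T G) p = egf (shift_s (shift_t b)) p"
    and G_tt: "pd_t T (pd_t T G) p = egf (shift_t (shift_t b)) p" if "p \<in> T" for p
    using that by (auto intro!: pd growth G_s G_t)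
  have G_sst: "pd_t T (pd_s T (pd_s T G)) p = egf (shift_t (shift_s (shift_s b))) p"
    and G_tts: "pd_s T (pd_t T (pd_t T G)) p = egf (shift_s (shift_t (shift_t b))) p"
    and G_ttt: "pd_t T (pd_t T (pd_t T G)) p = egf (shift_t (shift_t (shift_t b))) p" if "p \<in> T" for p
    using that by (auto intro!: pd growth G_ss G_tt)

  have pde: "3 * pd_t T (pd_s T (pd_s T G)) p - 3 * pd_s T (pd_t T (pd_t T G)) p
         + pd_t T (pd_t T (pd_t T G)) p
         + \<i> * of_real a * (2 * pd_s T (pd_t T G) p - pd_t T (pd_t T G) p)
         + of_real d * pd_t T G p - of_real \<rho> * G p = 0" if "p \<in> T" for p
    using egf_goursat_pde[of a d \<rho> p] that
    by (simp only: G_sst G_tts G_ttt G_ts G_tt G_t) (simp add: G_def b_def)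
  \<comment> \<open>Solving the equation for its first term gives exactly
    \<open>D_op\<close>.\<close>
  have D: "D_op T a d \<rho> G p = egf (shift_t (shift_s (shift_s b))) p" if "p \<in> T" for p
    using pde[OF that] G_sst[OF that] by (simp add: D_op_def field_simps)

  have G_0: "G (0, t) = 0" "egf (shift_t b) (0, t) = 0" for t
    using egf_on_t_axis[of b 0 0 t] egf_on_t_axis[of "shift_t b" 0 0 t] by (simp_all add: G_def b_def)
  \<comment> \<open>The only nonzero entry of column 1 has index 1; a shift in \<open>t\<close>
    moves it to index 0, turning a linear function of \<open>t\<close> into a constant.\<close>
  have G_s0: "egf (shift_s b) (0, t) = - of_real (\<rho> * t / 3)"
    and G_st0: "egf (shift_t (shift_s b)) (0, t) = - of_real (\<rho> / 3)" for t
    using egf_on_t_axis[of "shift_s b" 1 "- of_real (\<rho> / 3)" t]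
      egf_on_t_axis[of "shift_t (shift_s b)" 0 "- of_real (\<rho> / 3)" t]
    by (simp_all add: b_def scaleR_conv_of_real)
  have G_s_axis: "G (s, 0) = 0" for s
    unfolding G_def
  proof (rule egf_on_s_axis)
    show "b i 0 = 0" for i
      unfolding b_def by (cases "(a, d, \<rho>, i, 0::nat)" rule: goursat_coeff.cases) auto
  qed

  \<comment> \<open>Three integrations leave boundary values on the axes. Only the mixed derivative
    at \<open>s = 0\<close> is nonzero, namely \<open>- of_real (\<rho> / 3)\<close>; its
    contribution cancels the explicit term.\<close>
  have "G (s, t) = - of_real (\<rho> / 3 * s * t)
      + integral {0..t} (\<lambda>\<eta>. integral {0..s} (\<lambda>\<omega>. integral {0..\<omega>} (\<lambda>\<xi>. D_op T a d \<rho> G (\<xi>, \<eta>))))"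
    if st: "(s, t) \<in> Delta L" for s t
  proof -
    have pos: "s > 0" "t > 0" "s + t < L" using st by (auto simp: Delta_def)
    have 1: "integral {0..\<omega>} (\<lambda>\<xi>. D_op T a d \<rho> G (\<xi>, \<eta>))
        = egf (shift_s (shift_t b)) (\<omega>, \<eta>) + of_real (\<rho> / 3)"
      if "\<eta> \<in> {0..t}" "\<omega> \<in> {0..s}" for \<eta> \<omega>
    proof -
      \<comment> \<open>The rectangle with corner \<open>(s, t)\<close> lies in the closed triangle,
        so \<open>D\<close> applies throughout.\<close>
      have "integral {0..\<omega>} (\<lambda>\<xi>. D_op T a d \<rho> G (\<xi>, \<eta>))
          = integral {0..\<omega>} (\<lambda>\<xi>. egf (shift_s (shift_s (shift_t b))) (\<xi>, \<eta>))"
        using that pos by (intro integral_cong D) (auto simp: T_def intro!: mem_closure_Delta)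
      then show ?thesis
        using integral_unique[OF has_integral_egf_shift_s[OF growth(2)[OF growth(3)[OF b]], of \<omega> \<eta>]] that
        by (simp add: G_st0)
    qed
    have 2: "integral {0..s} (\<lambda>\<omega>. integral {0..\<omega>} (\<lambda>\<xi>. D_op T a d \<rho> G (\<xi>, \<eta>)))
        = egf (shift_t b) (s, \<eta>) + of_real (\<rho> / 3 * s)"
      if "\<eta> \<in> {0..t}" for \<eta>
    proof -
      have "((\<lambda>\<omega>. egf (shift_s (shift_t b)) (\<omega>, \<eta>) + of_real (\<rho> / 3)) has_integral
          (egf (shift_t b) (s, \<eta>) - egf (shift_t b) (0, \<eta>) + measure lborel {0..s} *\<^sub>R of_real (\<rho> / 3))) {0..s}"
        using pos by (intro has_integral_add has_integral_egf_shift_s has_integral_const_real growth) auto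
      from integral_unique[OF this] show ?thesis
        using integral_cong[of "{0..s}", OF 1[OF that]] pos by (simp add: G_0 scaleR_conv_of_real mult.commute)
    qed
    have "((\<lambda>\<eta>. egf (shift_t b) (s, \<eta>) + of_real (\<rho> / 3 * s)) has_integral
        (egf b (s, t) - egf b (s, 0) + measure lborel {0..t} *\<^sub>R of_real (\<rho> / 3 * s))) {0..t}"
      using pos by (intro has_integral_add has_integral_egf_shift_t has_integral_const_real growth) auto
    from integral_unique[OF this] show ?thesis
      using integral_cong[of "{0..t}", OF 2] G_s_axis[of s] pos by (simp add: G_def scaleR_conv_of_real mult_ac)
  qed
  moreover have "pd_s T G (0, t) = - of_real (\<rho> * t / 3)" if "t \<in> {0<..<L}" for t
    using that G_s[of "(0, t)"] mem_closure_Delta[of 0 t L] by (simp add: T_def G_s0)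
  moreover have "smooth_on T G"
    unfolding G_def by (rule smooth_on_egf[OF T b])
  ultimately show ?thesis
    unfolding Let_def a_def[symmetric] d_def[symmetric] \<rho>_def[symmetric] T_def[symmetric]
    using pde sub G_0(1) G_s_axis by (intro exI[of _ G]) auto
qed

end
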